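(* Let $D$ be an odd spoof perfect number, written as $D=pq$ with $q\in\mathcal{S}$ and $p$ its pseudo-prime factor; that is, $q$ is an odd positive integer, $p>1$ is an odd integer that is not prime, and $$\frac{2q}{\sigma(q)}-1=\frac1p .$$ If $D\neq 198585576189$, then $q>10^{12}$.
   Context: $\sigma(n)$ denotes the sum of all positive divisors of the positive integer $n$. $\mathcal{S}$ denotes the set of odd positive integers $n$ such that $\frac{2n}{\sigma(n)}-1=\frac1x$ for some positive integer $x$ (this $x$ is uniquely determined by $n$). If $n\in\mathcal{S}$ and the corresponding integer $x>1$ is odd but not prime, the number $D=nx$ is called an odd spoof perfect number (it would be perfect if only $x$ were prime), and $x$ is called its pseudo-prime factor. The only currently known example, due to Descartes, is $D=198585576189$, with $n=9018009$ and $x=22021$. *)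

theory Defs
  imports Complex_Main "HOL-Computational_Algebra.Primes"
begin

definition sigma :: "nat \<Rightarrow> nat" where
  "sigma n = (\<Sum>d | d dvd n. d)"

definition spoof_relation :: "nat \<Rightarrow> nat \<Rightarrow> bool" where
  "spoof_relation n x \<longleftrightarrow> 2 * real n / real (sigma n) - 1 = 1 / real x"

text \<open>Positivity of the elements is implied, as \<open>0\<close> is even.\<close>
definition spoof_set :: "nat set" where
  "spoof_set = {n. odd n \<and> (\<exists>x>0. spoof_relation n x)}"

lemma spoof_relation_unique:
  assumes "spoof_relation n x" "spoof_relation n y"
  shows "x = y"
proof -
  have "1 / real x = 1 / real y"
    using assms by (simp add: spoof_relation_def)
  then show ?thesis
    by (cases "x = 0"; cases "y = 0") (simp_all add: field_simps)
qed

definition pseudo_prime_factor :: "nat \<Rightarrow> nat \<Rightarrow> bool" where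
  "pseudo_prime_factor n x \<longleftrightarrow>
     n \<in> spoof_set \<and> spoof_relation n x \<and> x > 1 \<and> odd x \<and> \<not> prime x"

definition odd_spoof_perfect :: "nat \<Rightarrow> bool" where
  "odd_spoof_perfect D \<longleftrightarrow> (\<exists>n x. pseudo_prime_factor n x \<and> D = n * x)"

end

theory Submission
  imports Defs "HOL-Library.FuncSet"
begin

text \<open>
  With \<open>h = (p + 1) / 2\<close> the spoof equation reads \<open>h \<sigma>(q) = (2h - 1) q\<close>. Hence \<open>h\<close> divides \<open>q\<close>,
  and \<open>\<sigma>(q)\<close> is odd, so that \<open>q = s\<^sup>2\<close>; it remains to treat the odd \<open>s \<le> 10\<^sup>6\<close> with
  \<open>\<sigma>(s\<^sup>2) / s\<^sup>2 = 2 - 1/h\<close>. These are searched by building up \<open>s = n t\<close> from its smallest prime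
  factors. If all primes of \<open>t > 1\<close> are at least \<open>R\<close> and \<open>t < R\<^bsup>k+1\<^esup>\<close>, then
  \<open>1 + 1/t < \<sigma>(t\<^sup>2) / t\<^sup>2 \<le> R / (R - k)\<close>, which confines \<open>h\<close> to a short interval. As soon as this
  interval lies below \<open>R\<close>, the number \<open>h\<close> is coprime to \<open>t\<close> and must already divide \<open>n\<^sup>2\<close>; usually
  no element of the interval qualifies, and the whole branch is discarded. A few thousand nodes
  remain, and only \<open>s = 3003\<close> survives.
\<close>

subsection \<open>Divisor sums\<close>

lemma sigma_mult_coprime:
  assumes "coprime a b" "a > 0" "b > 0"
  shows "sigma (a * b) = sigma a * sigma b"
proof -
  have "bij_betw (\<lambda>(d, e). d * e) ({d. d dvd a} \<times> {e. e dvd b}) {d. d dvd a * b}"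
  proof (rule bij_betw_imageI)
    show "inj_on (\<lambda>(d, e). d * e) ({d. d dvd a} \<times> {e. e dvd b})"
    proof (rule inj_onI, clarsimp)
      fix d e d' e' :: nat
      assume *: "d dvd a" "e dvd b" "d' dvd a" "e' dvd b" "d * e = d' * e'"
      have "coprime d e'" "coprime d' e"
        using * assms by (meson coprime_divisors)+
      then have "d dvd d'" "d' dvd d"
        using * by (metis coprime_dvd_mult_left_iff dvd_triv_left)+
      then have "d = d'" by (rule dvd_antisym)
      moreover have "d > 0" using * assms(2) by (auto intro: dvd_pos_nat)
      ultimately show "d = d' \<and> e = e'" using * by simp
    qed
    show "(\<lambda>(d, e). d * e) ` ({d. d dvd a} \<times> {e. e dvd b}) = {d. d dvd a * b}"
      by (auto simp: image_iff intro: mult_dvd_mono elim!: division_decomp[THEN exE] dest: division_decomp)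
  qed
  then have "sigma (a * b) = (\<Sum>(d, e)\<in>{d. d dvd a} \<times> {e. e dvd b}. d * e)"
    unfolding sigma_def by (simp add: sum.reindex_bij_betw[symmetric] case_prod_unfold)
  then show ?thesis
    by (simp add: sigma_def sum_product sum.cartesian_product)
qed

lemma sigma_prime_power:
  assumes "prime p"
  shows "sigma (p ^ k) = (\<Sum>i\<le>k. p ^ i)"
proof -
  have "{d. d dvd p ^ k} = (\<lambda>i. p ^ i) ` {..k}"
    using divides_primepow_nat[OF assms] by auto
  moreover have "inj_on (\<lambda>i. p ^ i) {..k}"
    using prime_gt_1_nat[OF assms] by (auto intro: inj_onI)
  ultimately show ?thesis by (simp add: sigma_def sum.reindex)
qed

lemma sigma_1 [simp]: "sigma (Suc 0) = 1"
  by (simp add: sigma_def)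

lemma sigma_pos: "n > 0 \<Longrightarrow> sigma n > 0"
  unfolding sigma_def by (subst sum_pos2[of _ 1]) auto

lemma sigma_square_gt:
  assumes "t > 1"
  shows "t\<^sup>2 + t < sigma (t\<^sup>2)"
proof -
  have "sum id {1, t, t\<^sup>2} \<le> sigma (t\<^sup>2)"
    unfolding sigma_def id_def using assms by (intro sum_mono2) auto
  moreover have "t\<^sup>2 \<noteq> t" "t\<^sup>2 \<noteq> 1" using assms by (auto simp: power2_eq_square)
  ultimately show ?thesis using assms by simp
qed

text \<open>The divisors of a non-square pair off as \<open>d\<close> and \<open>n div d\<close>.
  Both are odd, so each pair has an even sum, and so does the total.\<close>

lemma square_if_odd_sigma:
  assumes "odd n" "odd (sigma n)"
  obtains s where "n = s\<^sup>2"
proof (rule ccontr)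
  assume "\<not> thesis"
  then have ns: "n \<noteq> d * d" for d using that by (auto simp: power2_eq_square)
  have n: "n > 0" using assms by (auto intro: Nat.gr0I)
  let ?L = "{d. d dvd n \<and> d * d < n}" and ?U = "{d. d dvd n \<and> n < d * d}"
  have fin: "finite ?L" "finite ?U" using n by auto
  have "bij_betw (\<lambda>d. n div d) ?L ?U"
  proof (rule bij_betwI[where g = "\<lambda>d. n div d"])
    show "(\<lambda>d. n div d) \<in> ?L \<rightarrow> ?U"
    proof clarsimp
      fix d assume d: "d dvd n" "d * d < n"
      then obtain e where e: "n = d * e" by auto
      have "d < e" using d e n by auto
      then show "n div d dvd n \<and> n < n div d * (n div d)" using d e n by auto
    qed
    show "(\<lambda>d. n div d) \<in> ?U \<rightarrow> ?L"
    proof clarsimp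
      fix d assume d: "d dvd n" "n < d * d"
      then obtain e where e: "n = d * e" by auto
      have "e < d" using d e n by auto
      then show "n div d dvd n \<and> n div d * (n div d) < n" using d e n by auto
    qed
  qed (use n in \<open>auto elim!: dvdE\<close>)
  then have "(\<Sum>d\<in>?U. d) = (\<Sum>d\<in>?L. n div d)"
    by (simp add: sum.reindex_bij_betw[symmetric])
  moreover have "{d. d dvd n} = ?L \<union> ?U" using ns by (auto simp: neq_iff)
  moreover have "(\<Sum>d\<in>?L \<union> ?U. d) = (\<Sum>d\<in>?L. d) + (\<Sum>d\<in>?U. d)"
    using fin by (intro sum.union_disjoint) auto
  ultimately have "sigma n = (\<Sum>d\<in>?L. d + n div d)"
    by (simp only: sigma_def sum.distrib)
  moreover have "even (\<Sum>d\<in>?L. d + n div d)"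
  proof (rule dvd_sum)
    fix d assume "d \<in> ?L"
    then obtain e where "n = d * e" by auto
    then show "even (d + n div d)" using assms(1) n by auto
  qed
  ultimately show False using assms(2) by simp
qed

lemma common_prime_factor:
  fixes a b :: nat
  assumes "\<not> coprime a b"
  obtains p where "prime p" "p dvd a" "p dvd b"
  using assms prime_factor_nat[of "gcd a b"] that by (auto simp: coprime_iff_gcd_eq_1)

section \<open>Numbers without small prime factors\<close>

definition rough :: "nat \<Rightarrow> nat \<Rightarrow> bool" where
  "rough R t \<longleftrightarrow> (\<forall>p. prime p \<longrightarrow> p dvd t \<longrightarrow> R \<le> p)"

lemma rough_1 [simp]: "rough R (Suc 0)"
  by (auto simp: rough_def)

lemma rough_dvd: "rough R t \<Longrightarrow> s dvd t \<Longrightarrow> rough R s"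
  unfolding rough_def by (blast intro: dvd_trans)

lemma rough_ge:
  assumes "rough R t" "t > 1"
  shows "R \<le> t"
proof -
  obtain p where "prime p" "p dvd t" using assms(2) prime_factor_nat[of t] by auto
  then show ?thesis using assms by (meson rough_def dvd_imp_le le_trans less_trans zero_less_one)
qed

lemma sigma_prime_power_le:
  assumes "prime r" "R \<le> r"
  shows "sigma (r ^ m) * (R - 1) \<le> r ^ m * R"
proof (cases R)
  case (Suc R')
  have r: "r > 1" using assms(1) by (rule prime_gt_1_nat)
  then obtain r' where r': "r = Suc r'" by (cases r) auto
  have "sigma (r ^ m) * (r - 1) + 1 = r ^ Suc m"
    unfolding sigma_prime_power[OF assms(1)]
    by (induction m) (auto simp: r' algebra_simps)
  then have "sigma (r ^ m) * (r - 1) \<le> r ^ m * r" by (simp add: mult.commute[of r])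
  then have *: "sigma (r ^ m) * (r - 1) * R \<le> r ^ m * r * R" by (rule mult_right_mono) simp
  have "(R - 1) * r \<le> (r - 1) * R"
    using assms(2) unfolding Suc r' by (simp add: algebra_simps)
  then have "sigma (r ^ m) * ((R - 1) * r) \<le> sigma (r ^ m) * ((r - 1) * R)"
    by (rule mult_left_mono) simp
  with * have "sigma (r ^ m) * (R - 1) * r \<le> r ^ m * R * r" by (simp add: algebra_simps)
  then show ?thesis using r by simp
qed simp

lemma prime_power_split:
  fixes r t :: nat
  assumes "prime r" "r dvd t" "t > 0"
  obtains a s where "t = r ^ a * s" "a > 0" "\<not> r dvd s"
proof -
  have "r \<noteq> 1" using assms(1) by auto
  then obtain s where s: "t = r ^ multiplicity r t * s" "\<not> r dvd s"
    using multiplicity_decompose'[of t r] assms by auto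
  moreover have "multiplicity r t > 0" using assms by (simp add: prime_multiplicity_gt_zero_iff)
  ultimately show ?thesis using that by blast
qed

text \<open>At most \<open>k\<close> distinct primes divide \<open>t\<close>, each contributing a
  factor of at most \<open>R / (R - 1)\<close>, and \<open>(R / (R - 1)) ^ k\<close> is at most
  \<open>R / (R - k)\<close> when \<open>k < R\<close>. Otherwise the truncated left side is
  \<open>0\<close>.\<close>

lemma sigma_square_rough_le:
  assumes "rough R t" "0 < t" "t < R ^ Suc k" "0 < R"
  shows "sigma (t\<^sup>2) * (R - k) \<le> t\<^sup>2 * R"
  using assms
proof (induction k arbitrary: t)
  case 0
  then have "t = 1" using rough_ge[of R t] by fastforce
  then show ?case by simp
next
  case (Suc k)
  show ?case
  proof (cases "t = 1 \<or> R \<le> Suc k")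
    case False
    then obtain r where r: "prime r" "r dvd t" using prime_factor_nat by blast
    then have Rr: "R \<le> r" using Suc.prems by (auto simp: rough_def)
    obtain a s where as: "t = r ^ a * s" "a > 0" "\<not> r dvd s"
      using r Suc.prems prime_power_split by blast
    have s: "rough R s" "0 < s" using Suc.prems as by (auto intro: rough_dvd)
    \<comment> \<open>Splitting off \<open>r\<close> removes a factor of at least \<open>R\<close>,
      which lowers the exponent in the bound for \<open>s\<close> by one.\<close>
    have "r ^ 1 \<le> r ^ a" using as prime_gt_0_nat[OF r(1)] by (intro power_increasing) auto
    then have "R * s \<le> t" using Rr unfolding as by (intro mult_right_mono) auto
    then have "R * s < R * R ^ Suc k" using Suc.prems(3) by (simp only: power_Suc[symmetric])
    then have "s < R ^ Suc k" by simp
    then have IH: "sigma (s\<^sup>2) * (R - k) \<le> s\<^sup>2 * R" using Suc.IH s Suc.prems by simp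
    have "coprime ((r ^ a)\<^sup>2) (s\<^sup>2)" using r(1) as(3) by (simp add: prime_imp_coprime)
    then have sg: "sigma (t\<^sup>2) = sigma (r ^ (2 * a)) * sigma (s\<^sup>2)"
      unfolding as using s prime_gt_0_nat[OF r(1)]
      by (simp add: power_mult_distrib sigma_mult_coprime flip: power_mult)
         (simp add: mult.commute)
    have "R * (R - Suc k) \<le> (R - 1) * (R - k)"
    proof -
      obtain m where "R = Suc k + Suc m"
        using False by (metis less_imp_Suc_add not_le add_Suc_right)
      then show ?thesis by (simp add: algebra_simps)
    qed
    then have "sigma (t\<^sup>2) * (R * (R - Suc k)) \<le> sigma (t\<^sup>2) * ((R - 1) * (R - k))"
      by (rule mult_left_mono) simp
    also have "\<dots> = (sigma (r ^ (2 * a)) * (R - 1)) * (sigma (s\<^sup>2) * (R - k))"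
      by (simp add: sg)
    also have "\<dots> \<le> (r ^ (2 * a) * R) * (s\<^sup>2 * R)"
      using sigma_prime_power_le[OF r(1) Rr] IH by (rule mult_mono) auto
    also have "\<dots> = t\<^sup>2 * R * R"
      by (simp add: as power_mult_distrib mult.commute[of 2 a] power_mult)
    finally have "R * (sigma (t\<^sup>2) * (R - Suc k)) \<le> R * (t\<^sup>2 * R)" by (simp add: algebra_simps)
    then show ?thesis using Suc.prems by simp
  qed auto
qed

definition next_prime :: "nat \<Rightarrow> nat" where
  "next_prime n = (LEAST p. prime p \<and> n < p)"

lemma next_prime: "prime (next_prime n)" "n < next_prime n"
proof -
  obtain p where "prime p \<and> n < p" using bigger_prime by blast
  then have "prime (next_prime n) \<and> n < next_prime n"
    unfolding next_prime_def by (rule LeastI)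
  then show "prime (next_prime n)" "n < next_prime n" by auto
qed

lemma next_prime_le: "prime p \<Longrightarrow> n < p \<Longrightarrow> next_prime n \<le> p"
  unfolding next_prime_def by (rule Least_le) simp

subsection \<open>The search\<close>

text \<open>
  Throughout, \<open>s = n t\<close>, \<open>S = \<sigma>(n\<^sup>2)\<close>, the primes of \<open>n\<close> are smaller than \<open>R\<close> and those of \<open>t\<close> are
  at least \<open>R\<close>. A prime \<open>d < R\<close> dividing \<open>S\<close> but not \<open>n\<close> has to divide \<open>2h - 1\<close>; otherwise it
  rules out \<open>h\<close>. Testing \<open>d = 7\<close> and \<open>d = 13\<close> already keeps the search tree small. For the values
  of \<open>h\<close> listed in \<open>excluded\<close>, the number \<open>p = 2h - 1\<close> is \<open>1\<close> or prime. The tests are written as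
  nested conditionals because the simplifier evaluates only the condition of an \<open>if\<close>, but both
  sides of a conjunction.
\<close>

definition foreign :: "nat \<Rightarrow> nat \<Rightarrow> nat \<Rightarrow> nat \<Rightarrow> nat \<Rightarrow> bool" where
  "foreign d n S R h =
     (if d < R then if (2 * h - 1) mod d = 0 then False
      else if n mod d = 0 then False else S mod d = 0 else False)"

definition excluded :: "nat \<Rightarrow> nat \<Rightarrow> nat \<Rightarrow> nat \<Rightarrow> bool" where
  "excluded n S R h =
     (if h \<in> {1, 3, 7, 9, 15, 21, 27} then True
      else if (n mod h)\<^sup>2 mod h \<noteq> 0 then True
      else if foreign 7 n S R h then True else foreign 13 n S R h)"

function all_excluded :: "nat \<Rightarrow> nat \<Rightarrow> nat \<Rightarrow> nat \<Rightarrow> nat \<Rightarrow> bool" where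
  "all_excluded n S R h m =
     (if m < h then True
      else if excluded n S R h then all_excluded n S R (h + 2) m else False)"
  by pat_completeness auto
termination by (relation "measure (\<lambda>(n, S, R, h, m). Suc m - h)") auto

text \<open>
  Here \<open>U = S R\<close>, \<open>V = n\<^sup>2 (R - k)\<close> and \<open>L = 2 n\<^sup>2 B - S (B + n)\<close> with \<open>B = 10\<^sup>6\<close>: the two bounds on
  \<open>\<sigma>(t\<^sup>2)\<close> become \<open>h (2V - U) \<le> V\<close> and \<open>n\<^sup>2 B < h L\<close>, and \<open>V < R (2V - U)\<close> ensures \<open>h < R\<close>. The lower
  end of the range is the least odd number above \<open>n\<^sup>2 B / L\<close>.
\<close>

definition quotients_excluded :: "nat \<Rightarrow> nat \<Rightarrow> nat \<Rightarrow> nat \<Rightarrow> nat \<Rightarrow> nat \<Rightarrow> bool" where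
  "quotients_excluded n S R U V L =
     (if 2 * V \<le> U then False
      else if R * (2 * V - U) \<le> V then False
      else all_excluded n S R (2 * ((n\<^sup>2 * 1000000 div L + 1) div 2) + 1) (V div (2 * V - U)))"

text \<open>The first \<open>k\<close> with \<open>1000000 < n * R ^ (k + 1)\<close> gives the
  sharpest bound \<open>R / (R - k)\<close>. For \<open>L = 0\<close> no \<open>h\<close> meets the
  lower bound.\<close>

definition pruned_by_quotients :: "nat \<Rightarrow> nat \<Rightarrow> nat \<Rightarrow> nat \<Rightarrow> nat \<Rightarrow> bool" where
  "pruned_by_quotients n S R N L =
     (if L = 0 then True
      else if 1000000 < n * R ^ 2 then quotients_excluded n S R (S * R) (N * (R - 1)) L
      else if 1000000 < n * R ^ 3 then quotients_excluded n S R (S * R) (N * (R - 2)) L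
      else if 1000000 < n * R ^ 4 then quotients_excluded n S R (S * R) (N * (R - 3)) L
      else False)"

definition pruned :: "nat \<Rightarrow> nat \<Rightarrow> nat \<Rightarrow> bool" where
  "pruned n S R =
     (if 1000000 < n * R then True
      else pruned_by_quotients n S R (n\<^sup>2) (2 * n\<^sup>2 * 1000000 - S * (1000000 + n)))"

text \<open>
  Here \<open>N = s\<^sup>2\<close> and \<open>T = \<sigma>(s\<^sup>2)\<close>. For \<open>2 N \<le> T\<close> the truncated difference is \<open>0\<close>, which does not
  divide \<open>N\<close>, as it should be.
\<close>

definition hit :: "nat \<Rightarrow> nat \<Rightarrow> bool" where
  "hit N T \<longleftrightarrow> 2 * N - T dvd N"

text \<open>
  \<open>search n S R\<close> covers all \<open>t > 1\<close>. In \<open>search_powers S R X Y\<close> the prime \<open>R\<close> has been given the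
  exponent \<open>a\<close>, so that \<open>X = n R\<^sup>a\<close> and \<open>Y = \<sigma>(R\<^bsup>2a\<^esup>)\<close>; it covers all larger exponents as well. The tests
  on \<open>n = 0\<close>, \<open>X = 0\<close> and \<open>R < 2\<close> only serve termination, as does the second test on \<open>n R\<close>.
\<close>

function search :: "nat \<Rightarrow> nat \<Rightarrow> nat \<Rightarrow> bool"
  and search_powers :: "nat \<Rightarrow> nat \<Rightarrow> nat \<Rightarrow> nat \<Rightarrow> bool"
where
  "search n S R =
    (if n = 0 \<or> R < 2 then False
     else if pruned n S R then True
     else if 1000000 < n * R then False
     else if search_powers S R (n * R) (R * R + R + 1) then search n S (next_prime R) else False)"
| "search_powers S R X Y =
    (if 1000000 < X then True else if X = 0 \<or> R < 2 then False
     else if (if hit (X * X) (S * Y) then X \<noteq> 3003 else False) then False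
     else if search X (S * Y) (next_prime R) then search_powers S R (X * R) (Y * R * R + R + 1)
     else False)"
  by pat_completeness auto
termination
\<comment> \<open>Either \<open>n\<close> or \<open>X\<close> grows, or \<open>search\<close> takes
  over at the same number, or \<open>R\<close> grows while \<open>n * R\<close> stays within the
  bound. Counting from \<open>1000001\<close> keeps the measure positive there.\<close>
proof (relation "measures [\<lambda>x. case x of Inl (n,S,R) \<Rightarrow> 1000001 - n | Inr (S,R,X,Y) \<Rightarrow> 1000001 - X,
      \<lambda>x. case x of Inl (n,S,R) \<Rightarrow> 0 | Inr (S,R,X,Y) \<Rightarrow> 1,
      \<lambda>x. case x of Inl (n,S,R) \<Rightarrow> 1000001 - R | Inr (S,R,X,Y) \<Rightarrow> 0]", goal_cases)
  have less: "1000001 - n * R < 1000001 - n" if "n \<noteq> 0" "\<not> R < 2" "\<not> 1000000 < n * R" for n R :: nat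
  proof -
    have "n * 2 \<le> n * R" using that by (intro mult_le_mono) auto
    then show ?thesis using that by linarith
  qed
  { case 1 then show ?case by simp
  next case (2 n S R) then show ?case using less[of n R] by simp
  next
    case (3 n S R)
    then have "1 * R \<le> n * R" by (intro mult_le_mono) auto
    then have "R \<le> 1000000" using 3 by linarith
    then have "1000001 - next_prime R < 1000001 - R" using next_prime(2)[of R] by linarith
    then show ?case by auto
  next case 4 then show ?case by auto
  next case (5 S R X Y)
    have "1000001 - X * R < 1000001 - X \<or> 1000000 < X * R"
      using less[of X R] 5(2) by metis
    then show ?case using 5 by auto }
qed

declare search.simps [simp del] search_powers.simps [simp del] all_excluded.simps [simp del]

subsection \<open>Completeness of the search\<close>

definition solution :: "nat \<Rightarrow> nat \<Rightarrow> bool" where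
  "solution s h \<longleftrightarrow> odd h \<and> h dvd s\<^sup>2 \<and> sigma (s\<^sup>2) * h + s\<^sup>2 = 2 * s\<^sup>2 * h \<and>
     h \<notin> {1, 3, 7, 9, 15, 21, 27}"

text \<open>A foreign prime \<open>d\<close> divides \<open>S\<close>, hence the product of
  \<open>n^2 * t^2\<close> and \<open>2 * h - 1\<close>. So it divides \<open>t\<close>, against
  \<open>d < R\<close>.\<close>

lemma excluded_complete:
  assumes "excluded n S R h" "rough R t" "h dvd n\<^sup>2" "h > 0"
    and "S * T * h + n\<^sup>2 * t\<^sup>2 = 2 * (n\<^sup>2 * t\<^sup>2) * h"
  shows "h \<in> {1, 3, 7, 9, 15, 21, 27}"
proof (rule ccontr)
  assume "\<not> ?thesis"
  moreover have "(n mod h)\<^sup>2 mod h = 0"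
    using assms(3) by (simp add: power_mod)
  ultimately obtain d where "foreign d n S R h" "prime d"
    using assms(1) that[of 7] that[of 13] unfolding excluded_def by (simp split: if_splits)
  then have d: "d < R" "d dvd S" "\<not> d dvd n" "\<not> d dvd 2 * h - 1"
    unfolding foreign_def dvd_eq_mod_eq_0 by (meson)+
  have "n\<^sup>2 * t\<^sup>2 * (2 * h - 1) = S * T * h"
    using assms(5) by (simp add: diff_mult_distrib2 algebra_simps)
  then have "d dvd n\<^sup>2 * t\<^sup>2 * (2 * h - 1)" using d(2) by simp
  then have "d dvd t"
    using d \<open>prime d\<close> by (auto simp: prime_dvd_mult_iff dest: prime_dvd_power)
  then show False using assms(2) d(1) \<open>prime d\<close> by (auto simp: rough_def)
qed

lemma all_excludedD:
  "all_excluded n S R h m \<Longrightarrow> odd h \<Longrightarrow> odd k \<Longrightarrow> h \<le> k \<Longrightarrow> k \<le> m \<Longrightarrow> excluded n S R k"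
proof (induction n S R h m rule: all_excluded.induct)
  case (1 n S R h m)
  then have *: "\<not> m < h" "excluded n S R h" "all_excluded n S R (h + 2) m"
    by (subst (asm) (2) all_excluded.simps; force split: if_splits)+
  show ?case
  proof (cases "k = h")
    case False
    then have "h + 2 \<le> k" using "1.prems"(2-4) by presburger
    then show ?thesis using "1.IH"[OF *] "1.prems" by simp
  qed (use * in simp)
qed

lemma quotients_excluded_complete:
  assumes "quotients_excluded n S R (S * R) (n\<^sup>2 * (R - k)) L"
    and "rough R t" "h dvd (n * t)\<^sup>2" "odd h" "t > 0"
    and eq: "S * T * h + n\<^sup>2 * t\<^sup>2 = 2 * (n\<^sup>2 * t\<^sup>2) * h"
    and lower: "n\<^sup>2 * 1000000 < h * L"
    and upper: "T * (R - k) \<le> t\<^sup>2 * R"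
  shows "h \<in> {1, 3, 7, 9, 15, 21, 27}"
proof -
  define U V where "U = S * R" and "V = n\<^sup>2 * (R - k)"
  have quot: "U < 2 * V" "V < R * (2 * V - U)"
      "all_excluded n S R (2 * ((n\<^sup>2 * 1000000 div L + 1) div 2) + 1) (V div (2 * V - U))"
    using assms(1) unfolding quotients_excluded_def U_def V_def by (auto split: if_splits)
  have h: "h > 0" using assms(4) by (auto intro: Nat.gr0I)
  \<comment> \<open>Scaling the equation by \<open>R - k\<close> makes \<open>upper\<close>
    applicable to \<open>T\<close>.\<close>
  have "2 * V * h * t\<^sup>2 = (S * h) * (T * (R - k)) + V * t\<^sup>2"
    using arg_cong[OF eq, of "\<lambda>x. x * (R - k)"] by (simp add: V_def algebra_simps)
  also have "\<dots> \<le> (S * h) * (t\<^sup>2 * R) + V * t\<^sup>2"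
    using upper by (intro add_right_mono mult_left_mono) auto
  also have "\<dots> = (U * h + V) * t\<^sup>2"
    by (simp add: U_def algebra_simps)
  finally have "2 * V * h \<le> U * h + V"
    using assms(5) by simp
  then have le: "h * (2 * V - U) \<le> V"
    by (simp add: diff_mult_distrib2 algebra_simps)
  then have "h * (2 * V - U) < R * (2 * V - U)" using quot(2) by linarith
  then have "h < R" by simp
  have "coprime h (t\<^sup>2)"
  proof (rule ccontr)
    assume "\<not> ?thesis"
    then obtain p where "prime p" "p dvd h" "p dvd t\<^sup>2"
      by (rule common_prime_factor)
    then show False
      using \<open>h < R\<close> h assms(2) prime_dvd_power[of p t 2] dvd_imp_le[of p h]
      by (auto simp: rough_def)
  qed
  then have dvd_n: "h dvd n\<^sup>2"
    using assms(3) by (simp add: power_mult_distrib coprime_dvd_mult_left_iff)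
  have upto: "h \<le> V div (2 * V - U)"
    using le quot(1) by (simp add: less_eq_div_iff_mult_less_eq)
  have "n\<^sup>2 * 1000000 div L < h"
    using lower by (intro less_mult_imp_div_less)
  moreover have "2 * ((x + 1) div 2) + 1 \<le> h" if "x < h" for x
    using that assms(4) by presburger
  ultimately have "2 * ((n\<^sup>2 * 1000000 div L + 1) div 2) + 1 \<le> h" by blast
  then show ?thesis
    using excluded_complete[OF all_excludedD[OF quot(3) _ assms(4) _ upto] assms(2) dvd_n h eq] by simp
qed

lemma pruned_complete:
  assumes "pruned n (sigma (n\<^sup>2)) R" "n > 0" "R > 0" "coprime n t"
    and "rough R t" "t > 1" "n * t \<le> 1000000"
  shows "\<not> solution (n * t) h"
proof
  assume sol: "solution (n * t) h"
  define S T L where "S = sigma (n\<^sup>2)" and "T = sigma (t\<^sup>2)"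
    and "L = 2 * n\<^sup>2 * 1000000 - S * (1000000 + n)"
  have "sigma ((n * t)\<^sup>2) = S * T"
    unfolding S_def T_def power_mult_distrib using assms by (intro sigma_mult_coprime) auto
  then have eq: "S * T * h + n\<^sup>2 * t\<^sup>2 = 2 * (n\<^sup>2 * t\<^sup>2) * h"
    and odd: "odd h" and dvd: "h dvd (n * t)\<^sup>2" and nin: "h \<notin> {1, 3, 7, 9, 15, 21, 27}"
    using sol by (auto simp: solution_def power_mult_distrib)
  have h: "h > 0" using dvd assms by (auto intro: Nat.gr0I)
  have S: "S > 0" unfolding S_def using assms by (simp add: sigma_pos)
  \<comment> \<open>Since \<open>n * t\<close> is at most \<open>1000000\<close>, the factor
    \<open>1 + 1/t\<close> can be weakened to \<open>1 + n/1000000\<close>, which is free of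
    \<open>t\<close>.\<close>
  have "S * (1000000 + n) * h * t + n\<^sup>2 * 1000000 * t \<le> S * h * 1000000 * (t + 1) + n\<^sup>2 * 1000000 * t"
    using mult_left_mono[OF assms(7), of "S * h"] by (simp add: algebra_simps)
  also have "\<dots> < 2 * n\<^sup>2 * 1000000 * h * t"
  proof -
    have "S * h * (t\<^sup>2 + t) < S * h * T"
      using S h sigma_square_gt[OF assms(6)] unfolding T_def by simp
    then have "t * (S * h * (t + 1) + n\<^sup>2 * t) < t * (2 * n\<^sup>2 * h * t)"
      using eq by (simp add: algebra_simps power2_eq_square)
    then have "S * h * (t + 1) + n\<^sup>2 * t < 2 * n\<^sup>2 * h * t" by simp
    then show ?thesis by (simp add: algebra_simps)
  qed
  finally have "(S * (1000000 + n) * h + n\<^sup>2 * 1000000) * t < (2 * n\<^sup>2 * 1000000 * h) * t"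
    by (simp only: algebra_simps)
  then have "S * (1000000 + n) * h + n\<^sup>2 * 1000000 < 2 * n\<^sup>2 * 1000000 * h" by simp
  then have lower: "n\<^sup>2 * 1000000 < h * L"
    unfolding L_def by (simp add: diff_mult_distrib2 algebra_simps)
  have "R \<le> t" using assms by (intro rough_ge)
  then have "n * R \<le> n * t" by simp
  then have "\<not> 1000000 < n * R" using assms(7) by linarith
  then have "pruned_by_quotients n S R (n\<^sup>2) L"
    using assms(1) unfolding pruned_def S_def L_def by simp
  moreover have "L \<noteq> 0" using lower by (intro notI) simp
  ultimately consider
      "1000000 < n * R ^ 2" "quotients_excluded n S R (S * R) (n\<^sup>2 * (R - 1)) L"
    | "1000000 < n * R ^ 3" "quotients_excluded n S R (S * R) (n\<^sup>2 * (R - 2)) L"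
    | "1000000 < n * R ^ 4" "quotients_excluded n S R (S * R) (n\<^sup>2 * (R - 3)) L"
    unfolding pruned_by_quotients_def by metis
  then obtain k where k: "1000000 < n * R ^ (k + 1)"
      "quotients_excluded n S R (S * R) (n\<^sup>2 * (R - k)) L"
  proof cases
    case 1 then show ?thesis using that[of 1] by (simp add: power2_eq_square)
  next
    case 2 then show ?thesis using that[of 2] by simp
  next
    case 3 then show ?thesis using that[of 3] by simp
  qed
  have "n * t < n * R ^ (k + 1)" using k(1) assms(7) by linarith
  then have "t < R ^ Suc k" by (simp only: nat_mult_less_cancel1[OF assms(2)] Suc_eq_plus1)
  then have "T * (R - k) \<le> t\<^sup>2 * R"
    unfolding T_def using assms by (intro sigma_square_rough_le) auto
  then show False
    using quotients_excluded_complete[OF k(2) assms(5) dvd odd _ eq lower] assms(6) nin by simp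
qed

lemma hit_complete:
  assumes "solution s h" "s > 0"
  shows "hit (s\<^sup>2) (sigma (s\<^sup>2))"
proof -
  have "h * (2 * s\<^sup>2 - sigma (s\<^sup>2)) = s\<^sup>2"
    using assms by (auto simp: solution_def diff_mult_distrib2 algebra_simps)
  then show ?thesis
    unfolding hit_def by (metis dvd_triv_right)
qed

lemma rough_next_prime:
  assumes "rough R t" "\<not> R dvd t"
  shows "rough (next_prime R) t"
  using assms unfolding rough_def by (metis next_prime_le le_neq_implies_less)

lemma rough_coprime:
  assumes "rough R t" "\<forall>p. prime p \<longrightarrow> p dvd n \<longrightarrow> p < R"
  shows "coprime n t"
  using assms unfolding rough_def by (metis common_prime_factor not_le)

text \<open>In the second statement \<open>b\<close> is the true exponent of \<open>R\<close> and
  \<open>a\<close> the one reached so far. Once \<open>a = b\<close>, the case \<open>t = 1\<close>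
  is caught by \<open>hit\<close> and \<open>t > 1\<close> by the nested
  \<open>search\<close>.\<close>

lemma search_complete:
  "search n S R \<Longrightarrow> S = sigma (n\<^sup>2) \<Longrightarrow> prime R \<Longrightarrow> \<forall>p. prime p \<longrightarrow> p dvd n \<longrightarrow> p < R \<Longrightarrow>
     rough R t \<Longrightarrow> t > 1 \<Longrightarrow> n * t \<le> 1000000 \<Longrightarrow> solution (n * t) h \<Longrightarrow> n * t = 3003"
  "search_powers S R X Y \<Longrightarrow> S = sigma (n\<^sup>2) \<Longrightarrow> prime R \<Longrightarrow> \<forall>p. prime p \<longrightarrow> p dvd n \<longrightarrow> p < R \<Longrightarrow>
     X = n * R ^ a \<Longrightarrow> Y = sigma (R ^ (2 * a)) \<Longrightarrow> a > 0 \<Longrightarrow> a \<le> b \<Longrightarrow>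
     rough (next_prime R) t \<Longrightarrow> t > 0 \<Longrightarrow> n * R ^ b * t \<le> 1000000 \<Longrightarrow> solution (n * R ^ b * t) h \<Longrightarrow>
     n * R ^ b * t = 3003"
proof (induction n S R and S R X Y arbitrary: t h and n a b t h rule: search_search_powers.induct)
  case (1 n S R)
  have n: "n > 0" "\<not> R < 2"
    using "1.prems"(1) by (subst (asm) search.simps; force split: if_splits)+
  have cop: "coprime n t" using "1.prems" by (intro rough_coprime)
  have np: "\<not> pruned n S R"
    using pruned_complete[of n R t h] cop n "1.prems" by auto
  have nR: "\<not> 1000000 < n * R" and
    P: "search_powers S R (n * R) (R * R + R + 1)" and Q: "search n S (next_prime R)"
    using "1.prems"(1) n np by (subst (asm) search.simps; force split: if_splits)+
  show ?case
  proof (cases "R dvd t")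
    case False
    have "\<forall>p. prime p \<longrightarrow> p dvd n \<longrightarrow> p < next_prime R"
      using "1.prems"(4) next_prime(2)[of R] less_trans by blast
    then show ?thesis
      using "1.IH"(2)[OF _ np nR P Q "1.prems"(2) next_prime(1) _ rough_next_prime] n False "1.prems"
      by auto
  next
    case True
    then obtain b s where bs: "t = R ^ b * s" "b > 0" "\<not> R dvd s"
      using "1.prems" prime_power_split[of R t] by auto
    have "rough (next_prime R) s"
      using bs "1.prems"(5) by (auto intro!: rough_next_prime intro: rough_dvd)
    moreover have "R * R + R + 1 = sigma (R ^ (2 * 1))"
      using sigma_prime_power[OF "1.prems"(3), of 2] by (simp add: eval_nat_numeral)
    moreover have "s > 0" using bs "1.prems"(6) by (auto intro: Nat.gr0I)
    ultimately show ?thesis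
      using "1.IH"(1)[OF _ np nR P "1.prems"(2,3,4), of 1 b s h] n bs "1.prems"(7,8)
      by (simp add: mult.assoc)
  qed
next
  case (2 S R X Y)
  have R: "R > 1" using "2.prems"(3) by (rule prime_gt_1_nat)
  have "R ^ a * 1 \<le> R ^ b * t"
    using R "2.prems"(8,10) by (intro mult_le_mono power_increasing) auto
  then have "n * (R ^ a * 1) \<le> n * (R ^ b * t)" by (rule mult_left_mono) simp
  then have le: "\<not> 1000000 < X" using "2.prems"(5,11) by (simp only: mult.assoc mult_1_right)
  then have X: "X > 0"
    using "2.prems"(1) by (subst (asm) search_powers.simps) (auto intro: Nat.gr0I split: if_splits)
  then have n: "n > 0" using "2.prems"(5) by (auto intro: Nat.gr0I)
  have H: "\<not> (if hit (X * X) (S * Y) then X \<noteq> 3003 else False)"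
    and P: "search X (S * Y) (next_prime R)" and Q: "search_powers S R (X * R) (Y * R * R + R + 1)"
    using "2.prems"(1) le X R by (subst (asm) search_powers.simps; force split: if_splits)+
  have "\<not> R dvd n" using "2.prems"(3,4) by blast
  then have "coprime (n\<^sup>2) (R ^ (2 * a))"
    using "2.prems"(3) by (simp add: prime_imp_coprime coprime_commute)
  then have SY: "S * Y = sigma (X\<^sup>2)"
    using "2.prems"(2,5,6) n R
    by (simp add: sigma_mult_coprime power_mult_distrib power_mult mult.commute[of 2 a])
  show ?case
  proof (cases "a = b")
    case False
    \<comment> \<open>Two Horner steps of the geometric sum.\<close>
    have "sigma (R ^ (2 * Suc a)) = Y * R * R + R + 1"
      unfolding "2.prems"(6) sigma_prime_power[OF "2.prems"(3)]
      by (simp add: sum.atMost_Suc_shift sum_distrib_left sum_distrib_right algebra_simps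
          del: sum.atMost_Suc)
    then show ?thesis
      using "2.IH"(2)[OF le _ H P Q "2.prems"(2,3,4), of "Suc a" b t h] X R False "2.prems"
      by (auto simp: mult_ac)
  next
    case True
    show ?thesis
    proof (cases "t = 1")
      case True
      then have "hit (X * X) (S * Y)"
        using hit_complete[of X h] SY X "2.prems"(5,12) \<open>a = b\<close> by (simp add: power2_eq_square)
      then show ?thesis using H True "2.prems"(5) \<open>a = b\<close> by auto
    next
      case False
      have "p < next_prime R" if "prime p" "p dvd X" for p
      proof -
        have "p dvd n \<or> p dvd R"
          using that "2.prems"(5) by (auto simp: prime_dvd_mult_iff dest: prime_dvd_power)
        then have "p < R \<or> p = R"
          using that(1) "2.prems"(3,4) by (auto simp: primes_dvd_imp_eq)
        then show ?thesis using next_prime(2)[of R] by auto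
      qed
      then show ?thesis
        using "2.IH"(1)[OF le _ H P SY next_prime(1), of t h] X R False "2.prems" \<open>a = b\<close> by auto
    qed
  qed
qed

subsection \<open>Evaluation\<close>

text \<open>
  The following equations allow the simplifier to compute remainders bit by bit, and quotients in
  a number of steps logarithmic in the quotient, with numerals rather than \<open>Suc\<close> throughout.
\<close>

definition reduce :: "nat \<Rightarrow> nat \<Rightarrow> nat" where
  "reduce m d = (if m < d then m else m - d)"

text \<open>A doubled residue plus one bit stays below \<open>2 * d\<close>, so one subtraction
  suffices.\<close>

lemma reduce_mod:
  assumes "c \<le> 1"
  shows "reduce (2 * (m mod d) + c) d = (2 * m + c) mod d"
proof (cases "d = 0")
  case False
  then have "2 * (m mod d) + c < 2 * d"
    using assms mod_less_divisor[of d m] by linarith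
  then have "reduce (2 * (m mod d) + c) d = (2 * (m mod d) + c) mod d"
    by (simp add: reduce_def mod_if[of "2 * (m mod d) + c"])
  then show ?thesis by (metis mod_add_left_eq mod_mult_right_eq)
qed (simp add: reduce_def)

lemma mod_eval:
  "(0 :: nat) mod d = 0"
  "numeral num.One mod d = reduce (numeral num.One) d"
  "numeral (num.Bit0 k) mod d = reduce (2 * (numeral k mod d)) d"
  "numeral (num.Bit1 k) mod d = reduce (2 * (numeral k mod d) + 1) d"
  using reduce_mod[of 0 "numeral k" d] reduce_mod[of 1 "numeral k" d] reduce_mod[of 1 0 d]
  by (simp_all add: numeral_Bit0 numeral_Bit1 mult_2)

definition div_mod :: "nat \<Rightarrow> nat \<Rightarrow> nat \<times> nat" where
  "div_mod m d = (m div d, m mod d)"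

definition div_mod_step :: "nat \<times> nat \<Rightarrow> nat \<Rightarrow> nat \<times> nat" where
  "div_mod_step x d = (if snd x < d then (2 * fst x, snd x) else (2 * fst x + 1, snd x - d))"

text \<open>The divisor is doubled until it exceeds \<open>m\<close>; each return then yields one
  binary digit of the quotient. Doubling \<open>0\<close> would never end, hence the second
  test.\<close>

lemma div_mod_eval:
  "div_mod m d = (if m < d then (0, m) else if d = 0 then (0, m) else div_mod_step (div_mod m (2 * d)) d)"
proof -
  have "div_mod m d = div_mod_step (div_mod m (2 * d)) d" if "d > 0"
  proof -
    define q r where "q = m div (2 * d)" and "r = m mod (2 * d)"
    have m: "m = 2 * d * q + r" by (simp add: q_def r_def)
    have "r < 2 * d" using that by (simp add: r_def)
    have eq: "div_mod_step (div_mod m (2 * d)) d = (if r < d then (2 * q, r) else (2 * q + 1, r - d))"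
      by (simp add: div_mod_def div_mod_step_def q_def r_def)
    show ?thesis
    proof (cases "r < d")
      case True
      then have "m div d = 2 * q" "m mod d = r"
        using m by (auto intro!: div_nat_eqI simp: algebra_simps mod_mult_self1)
      then show ?thesis using True unfolding eq by (simp add: div_mod_def)
    next
      case False
      then have "m = (2 * q + 1) * d + (r - d)" using m by (simp add: algebra_simps)
      moreover have "r - d < d" using False \<open>r < 2 * d\<close> by linarith
      ultimately have "m div d = 2 * q + 1" "m mod d = r - d"
        by (metis div_mult_self3 div_less add_0_right less_nat_zero_code, metis mod_mult_self3 mod_less)
      then show ?thesis using False unfolding eq by (simp add: div_mod_def)
    qed
  qed
  then show ?thesis by (simp add: div_mod_def)
qed

lemma div_eval: "m div d = fst (div_mod m d)"
  and dvd_eval: "d dvd m \<longleftrightarrow> snd (div_mod m d) = 0"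
  by (simp_all add: div_mod_def dvd_eq_mod_eq_0)

section \<open>Computing successive primes\<close>

lemma next_prime_eqI:
  assumes "prime b" "a < b" "\<forall>c\<in>set [Suc a..<b]. \<not> prime c"
  shows "next_prime a = b"
  using assms next_prime[of a] next_prime_le[of b a]
  by (metis atLeastLessThan_upt atLeastLessThan_iff Suc_leI le_neq_implies_less)

definition has_small_factor :: "nat \<Rightarrow> bool" where
  "has_small_factor n =
     (if n mod 2 = 0 then True else if n mod 3 = 0 then True else if n mod 5 = 0 then True
      else if n mod 7 = 0 then True else if n mod 11 = 0 then True else if n mod 13 = 0 then True
      else if n mod 17 = 0 then True else n mod 19 = 0)"

lemma has_small_factor_altdef:
  "has_small_factor n \<longleftrightarrow> (\<exists>d\<in>{2, 3, 5, 7, 11, 13, 17, 19}. d dvd n)"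
  unfolding has_small_factor_def dvd_eq_mod_eq_0 if_bool_eq_disj
  by (simp only: bex_simps simp_thms) argo

text \<open>A composite number below \<open>529 = 23^2\<close> has a prime factor below
  \<open>23\<close>; above \<open>22\<close>, such a factor is proper.\<close>

lemma has_small_factor_iff:
  assumes "22 < n" "n < 529"
  shows "has_small_factor n \<longleftrightarrow> \<not> prime n"
proof
  assume "has_small_factor n"
  then obtain d where "d dvd n" "d \<in> {2, 3, 5, 7, 11, 13, 17, 19}"
    unfolding has_small_factor_altdef by blast
  then show "\<not> prime n" using assms(1) unfolding prime_nat_iff by fastforce
next
  assume "\<not> prime n"
  obtain p where p: "prime p" "p dvd n" using prime_factor_nat[of n] assms by auto
  obtain m where m: "n = p * m" using p(2) by auto
  have small: "has_small_factor n" if r: "prime r" "r dvd n" "r < 23" for r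
  proof -
    have "r \<in> {0, 1, 2, 3, 4, 5, 6, 7, 8, 9, 10, 11, 12, 13, 14, 15, 16, 17, 18, 19, 20, 21, 22}"
      using r(3) unfolding insert_iff empty_iff by presburger
    then have "r \<in> {2, 3, 5, 7, 11, 13, 17, 19}" using r(1) by auto
    then show ?thesis using r(2) unfolding has_small_factor_altdef by blast
  qed
  show "has_small_factor n"
  proof (cases "p < 23")
    case False
    then have "m < 23" using assms(2) mult_le_mono[of 23 p 23 m] unfolding m by linarith
    have "m \<noteq> 1" using \<open>\<not> prime n\<close> p(1) m by auto
    then obtain r where "prime r" "r dvd m" using prime_factor_nat by blast
    moreover have "m > 0" using m assms(1) by (auto intro: Nat.gr0I)
    ultimately show ?thesis
      using small[of r] \<open>m < 23\<close> dvd_imp_le[of r m] unfolding m by (auto intro: dvd_mult)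
  qed (use small p in blast)
qed

lemma next_prime_small:
  "next_prime 3 = 5" "next_prime 5 = 7" "next_prime 7 = 11" "next_prime 11 = 13"
  "next_prime 13 = 17" "next_prime 17 = 19" "next_prime 19 = 23"
  by (rule next_prime_eqI; simp)+

lemma next_prime_step:
  assumes "22 \<le> n" "n < 528"
  shows "next_prime n = (if has_small_factor (n + 1) then next_prime (n + 1) else n + 1)"
proof (cases "prime (n + 1)")
  case True
  then have "next_prime n = n + 1"
    using next_prime(2)[of n] next_prime_le[of "n + 1" n] by simp
  then show ?thesis using True assms has_small_factor_iff[of "n + 1"] by simp
next
  case False
  then have "next_prime n \<noteq> n + 1" using next_prime(1)[of n] by metis
  then have "next_prime (n + 1) \<le> next_prime n"
    using next_prime[of n] by (intro next_prime_le) auto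
  moreover have "next_prime n \<le> next_prime (n + 1)"
    using next_prime[of "n + 1"] by (intro next_prime_le) auto
  ultimately show ?thesis using False assms has_small_factor_iff[of "n + 1"] by simp
qed

text \<open>The primes up to \<open>401\<close> suffice for evaluating
  \<open>search 1 1 3\<close>.\<close>

lemma next_prime_table:
  "next_prime 23 = 29" "next_prime 29 = 31" "next_prime 31 = 37" "next_prime 37 = 41"
  "next_prime 41 = 43" "next_prime 43 = 47" "next_prime 47 = 53" "next_prime 53 = 59"
  "next_prime 59 = 61" "next_prime 61 = 67" "next_prime 67 = 71" "next_prime 71 = 73"
  "next_prime 73 = 79" "next_prime 79 = 83" "next_prime 83 = 89" "next_prime 89 = 97"
  "next_prime 97 = 101" "next_prime 101 = 103" "next_prime 103 = 107" "next_prime 107 = 109"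
  "next_prime 109 = 113" "next_prime 113 = 127" "next_prime 127 = 131" "next_prime 131 = 137"
  "next_prime 137 = 139" "next_prime 139 = 149" "next_prime 149 = 151" "next_prime 151 = 157"
  "next_prime 157 = 163" "next_prime 163 = 167" "next_prime 167 = 173" "next_prime 173 = 179"
  "next_prime 179 = 181" "next_prime 181 = 191" "next_prime 191 = 193" "next_prime 193 = 197"
  "next_prime 197 = 199" "next_prime 199 = 211" "next_prime 211 = 223" "next_prime 223 = 227"
  "next_prime 227 = 229" "next_prime 229 = 233" "next_prime 233 = 239" "next_prime 239 = 241"
  "next_prime 241 = 251" "next_prime 251 = 257" "next_prime 257 = 263" "next_prime 263 = 269"
  "next_prime 269 = 271" "next_prime 271 = 277" "next_prime 277 = 281" "next_prime 281 = 283"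
  "next_prime 283 = 293" "next_prime 293 = 307" "next_prime 307 = 311" "next_prime 311 = 313"
  "next_prime 313 = 317" "next_prime 317 = 331" "next_prime 331 = 337" "next_prime 337 = 347"
  "next_prime 347 = 349" "next_prime 349 = 353" "next_prime 353 = 359" "next_prime 359 = 367"
  "next_prime 367 = 373" "next_prime 373 = 379" "next_prime 379 = 383" "next_prime 383 = 389"
  "next_prime 389 = 397" "next_prime 397 = 401"
  by (simp_all only: next_prime_step has_small_factor_def mod_eval reduce_def numeral_One[symmetric]
      arith_simps rel_simps diff_nat_numeral nat_numeral nat_0 nat_neg_numeral
      simp_thms if_True if_False cong: if_weak_cong)

text \<open>The whole search, run by rewriting. \<open>if_weak_cong\<close> freezes both branches
  until the condition is decided, so pruned subtrees are never unfolded.\<close>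

lemma search_root: "search 1 1 3"
  by (simp only: search.simps search_powers.simps pruned_def pruned_by_quotients_def
      quotients_excluded_def all_excluded.simps excluded_def foreign_def hit_def
      next_prime_small next_prime_table mod_eval reduce_def div_mod_eval div_mod_step_def div_eval dvd_eval
      fst_conv snd_conv numeral_One[symmetric] arith_simps rel_simps power_numeral power_zero_numeral pow.simps
      sqr.simps diff_nat_numeral nat_numeral nat_0 nat_neg_numeral insert_iff empty_iff
      simp_thms if_True if_False cong: if_weak_cong)

subsection \<open>Spoof perfect numbers below the bound\<close>

lemma quotient_of_spoof:
  assumes "pseudo_prime_factor q p"
  obtains s h where "q = s\<^sup>2" "odd s" "p = 2 * h - 1" "solution s h"
proof -
  have p: "p > 1" "odd p" "\<not> prime p" "odd q" and rel: "spoof_relation q p"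
    using assms by (auto simp: pseudo_prime_factor_def spoof_set_def)
  then have q: "q > 0" by (auto intro: Nat.gr0I)
  have sg: "sigma q > 0" using q by (rule sigma_pos)
  obtain k where k: "p = 2 * k + 1" using p(2) by (rule oddE)
  define h where "h = Suc k"
  have ph: "p = 2 * h - 1" "h > 0" using k by (simp_all add: h_def)
  have "2 * real q * real p = real (sigma q) + real p * real (sigma q)"
    using rel p(1) sg by (simp add: spoof_relation_def field_simps)
  then have "real (2 * q * p) = real ((p + 1) * sigma q)" by (simp add: distrib_right)
  then have "2 * q * p = (p + 1) * sigma q" by (simp only: of_nat_eq_iff)
  then have eq: "q * p = h * sigma q" by (simp add: k h_def)
  \<comment> \<open>\<open>p\<close> and \<open>2 * h\<close> are consecutive.\<close>
  have "coprime h p"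
    using coprime_diff_one_right_nat[of "2 * h"] ph by (auto simp: coprime_mult_right_iff intro: coprime_divisors)
  then have "h dvd q" using eq by (metis coprime_dvd_mult_left_iff dvd_triv_left)
  have "odd (h * sigma q)" using eq p by (metis even_mult_iff)
  then obtain s where s: "q = s\<^sup>2" using square_if_odd_sigma p(4) by auto
  have "sigma q * h + q = 2 * q * h"
    using eq by (simp add: k h_def algebra_simps)
  moreover have "h \<notin> {1, 3, 7, 9, 15, 21, 27}"
  proof
    assume "h \<in> {1, 3, 7, 9, 15, 21, 27}"
    then have "p \<in> {1, 5, 13, 17, 29, 41, 53}" using ph by auto
    then show False using p(1,3) by auto
  qed
  moreover have "odd h" using \<open>h dvd q\<close> p(4) dvd_trans by blast
  ultimately have "solution s h" using \<open>h dvd q\<close> s by (simp add: solution_def)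
  moreover have "odd s" using s p(4) by auto
  ultimately show ?thesis using that s ph by blast
qed

theorem theorem1:
  fixes D p q :: nat
  assumes "odd_spoof_perfect D"
    and "D = p * q"
    and "q \<in> spoof_set"
    and "pseudo_prime_factor q p"
    and "D \<noteq> 198585576189"
  shows "q > 10 ^ 12"
proof (rule ccontr)
  assume small: "\<not> q > 10 ^ 12"
  obtain s h where s: "q = s\<^sup>2" "odd s" "p = 2 * h - 1" "solution s h"
    using quotient_of_spoof[OF assms(4)] by blast
  have "s\<^sup>2 \<le> (10 ^ 6)\<^sup>2" using small s(1) by simp
  then have "s \<le> 1000000" by (simp only: power2_nat_le_eq_le) simp
  moreover have "rough 3 s"
    unfolding rough_def
  proof (intro allI impI)
    fix r assume "prime r" "r dvd s"
    then show "3 \<le> r" using s(2) prime_ge_2_nat[of r] by (cases "r = 2") auto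
  qed
  moreover have "s \<noteq> 1" using s(4) by (auto simp: solution_def)
  moreover have "s > 0" using s(2) by (cases s) auto
  ultimately have "s = 3003"
    using search_complete(1)[OF search_root, of s h] s(4) by auto
  have sq: "sigma (r\<^sup>2) = 1 + r + r * r" if "prime r" for r
    using sigma_prime_power[OF that, of 2] by (simp add: numeral_2_eq_2)
  have prime: "prime (3::nat)" "prime (7::nat)" "prime (11::nat)" "prime (13::nat)" by simp_all
  then have cop: "coprime (3\<^sup>2 :: nat) (7\<^sup>2 * (11\<^sup>2 * 13\<^sup>2))" "coprime (7\<^sup>2 :: nat) (11\<^sup>2 * 13\<^sup>2)"
      "coprime (11\<^sup>2 :: nat) (13\<^sup>2)"
    by (simp_all only: coprime_mult_right_iff coprime_power_left_iff coprime_power_right_iff)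
      (simp_all add: primes_coprime)
  have "sigma (3\<^sup>2 * (7\<^sup>2 * (11\<^sup>2 * 13\<^sup>2))) = sigma (3\<^sup>2) * (sigma (7\<^sup>2) * (sigma (11\<^sup>2) * sigma (13\<^sup>2)))"
    by (subst sigma_mult_coprime[OF cop(1)], simp, simp,
        subst sigma_mult_coprime[OF cop(2)], simp, simp,
        subst sigma_mult_coprime[OF cop(3)], simp_all only:) simp_all
  then have "sigma (3003\<^sup>2) = 18035199" using prime by (simp only: sq) simp
  \<comment> \<open>Here \<open>2 * 9018009 - 18035199 = 819\<close> and
    \<open>9018009 = 819 * 11011\<close>. So \<open>p = 22021\<close>, and \<open>D\<close> is the
    number of Descartes.\<close>
  with \<open>s = 3003\<close> have "h = 11011" using s(4) by (simp add: solution_def)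
  then show False using assms(2,5) s \<open>s = 3003\<close> by simp
qed

end
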